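(* Let $s \geq 1$ and $k \geq 1$ be integers and suppose $A \in \mathcal{M}_n^{+}$ has factor width at most $k$. Then $A^{\odot s}$ has factor width at most $k$. Furthermore, \[ \mathrm{fran}_k\big(A^{\odot s}\big) \leq \binom{\mathrm{fran}_k(A)+s-1}{s}. \]
   Context: Let $\mathbb{F} \in \{\mathbb{R},\mathbb{C}\}$ (the result holds for either field). $\mathcal{M}_n^{+}$ denotes the set of $n \times n$ positive semidefinite (real symmetric if $\mathbb{F}=\mathbb{R}$, Hermitian if $\mathbb{F}=\mathbb{C}$) matrices over $\mathbb{F}$. $A^{\odot s}$ is the $s$-th Hadamard (entrywise) power, with $(i,j)$-entry $a_{i,j}^s$. The factor width of $A \in \mathcal{M}_n^{+}$ is the smallest positive integer $k$ such that $A = \sum_{j=1}^r \mathbf{v}_j\mathbf{v}_j^*$ for some $r$ and some $\mathbf{v}_1,\ldots,\mathbf{v}_r \in \mathbb{F}^n$, each with at most $k$ non-zero entries. If $A$ has factor width at most $k$, $\mathrm{fran}_k(A)$ (the factor-width-$k$ rank) is the least integer $r$ for which such a decomposition with vectors having at most $k$ non-zero entries exists (the zero matrix being an empty sum, $r=0$). *)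

theory Defs
  imports Jordan_Normal_Form.Schur_Decomposition "HOL-Library.Extended_Nat"
begin

text \<open>The real and the complex case share one set of definitions: \<open>conjugate\<close> is the identity
  on \<^typ>\<open>real\<close> and \<^const>\<open>cnj\<close> on \<^typ>\<open>complex\<close>, and in the order on \<^typ>\<open>complex\<close> from
  \<^theory>\<open>HOL-Library.Complex_Order\<close>, \<open>0 \<le> z\<close> says that \<open>z\<close> is real and nonnegative.\<close>

definition psd_mats :: "nat \<Rightarrow> 'a::conjugatable_ordered_field mat set" where
  "psd_mats n = {A \<in> carrier_mat n n.
     mat_adjoint A = A \<and> (\<forall>x \<in> carrier_vec n. 0 \<le> (A *\<^sub>v x) \<bullet>c x)}"

definition hadamard_power :: "'a::monoid_mult mat \<Rightarrow> nat \<Rightarrow> 'a mat" where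
  "hadamard_power A s = map_mat (\<lambda>a. a ^ s) A"

definition num_nonzero :: "'a::zero vec \<Rightarrow> nat" where
  "num_nonzero v = card {i. i < dim_vec v \<and> v $ i \<noteq> 0}"

text \<open>The rank one matrix \<open>v v\<^sup>*\<close>.\<close>

definition outer_square :: "'a::conjugatable_ring vec \<Rightarrow> 'a mat" where
  "outer_square v = mat (dim_vec v) (dim_vec v) (\<lambda>(i, j). v $ i * conjugate (v $ j))"

definition sparse_decomposition ::
  "nat \<Rightarrow> 'a::conjugatable_ordered_field mat \<Rightarrow> 'a vec list \<Rightarrow> bool" where
  "sparse_decomposition k A vs \<longleftrightarrow>
     (\<forall>v \<in> set vs. v \<in> carrier_vec (dim_row A) \<and> num_nonzero v \<le> k) \<and>
     A = foldr (+) (map outer_square vs) (0\<^sub>m (dim_row A) (dim_row A))"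

text \<open>The value is \<open>\<infinity>\<close> exactly when no decomposition exists at all, so that
  \<open>factor_width A \<le> k\<close> always entails the existence of a decomposition.\<close>

definition factor_width :: "'a::conjugatable_ordered_field mat \<Rightarrow> enat" where
  "factor_width A = Inf {enat k | k. 1 \<le> k \<and> (\<exists>vs. sparse_decomposition k A vs)}"

text \<open>Only meaningful when \<open>factor_width A \<le> k\<close>.\<close>

definition fran :: "nat \<Rightarrow> 'a::conjugatable_ordered_field mat \<Rightarrow> nat" where
  "fran k A = (LEAST r. \<exists>vs. sparse_decomposition k A vs \<and> length vs = r)"

lemma factor_width_le_iff:
  assumes "1 \<le> k"
  shows "factor_width A \<le> enat k \<longleftrightarrow> (\<exists>vs. sparse_decomposition k A vs)"
proof
  let ?S = "{enat j | j. 1 \<le> j \<and> (\<exists>vs. sparse_decomposition j A vs)}"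
  assume le: "factor_width A \<le> enat k"
  then have "?S \<noteq> {}"
    unfolding factor_width_def by (metis Inf_empty enat_ord_code(5) top_enat_def)
  then have "Inf ?S \<in> ?S"
    unfolding Inf_enat_def by (metis (no_types, lifting) LeastI_ex ex_in_conv)
  then obtain j vs where "factor_width A = enat j" "sparse_decomposition j A vs"
    unfolding factor_width_def by auto
  with le have "sparse_decomposition k A vs"
    unfolding sparse_decomposition_def by fastforce
  then show "\<exists>vs. sparse_decomposition k A vs" ..
next
  assume "\<exists>vs. sparse_decomposition k A vs"
  with assms show "factor_width A \<le> enat k"
    unfolding factor_width_def by (auto intro: Inf_lower)
qed

end

theory Submission
  imports Defs
begin

text \<open>Entrywise, a decomposition \<open>A = \<Sum> v v\<^sup>*\<close> reads \<open>a\<^sub>i\<^sub>j = \<Sum> v\<^sub>i \<cdot> conj v\<^sub>j\<close>. Raising this to the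
  power \<open>s\<close> and expanding by the multinomial theorem gives one term for each multiset \<open>M\<close> of
  \<open>s\<close> of the vectors. Each multinomial coefficient is a natural number and hence of the form
  \<open>c \<cdot> conj c\<close>, so that the term is \<open>w\<^sub>i \<cdot> conj w\<^sub>j\<close> where \<open>w\<close> is \<open>c\<close> times the entrywise
  product of the vectors in \<open>M\<close>. As \<open>s \<ge> 1\<close>, the vector \<open>w\<close> is an entrywise multiple of
  some \<open>v\<close> and so inherits its sparsity; and there are \<open>r + s - 1\<close> choose \<open>s\<close> multisets of
  size \<open>s\<close> on \<open>r\<close> vectors.

  The lemma \<open>gram_sum_power_expansion\<close> carries this out by splitting off one vector at a time
  with the binomial theorem. Multisets then need not be mentioned: their number appears as the
  hockey-stick sum \<open>sum_multichoose\<close>, and each product of square roots of binomial coefficients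
  is a square root of a multinomial coefficient.\<close>

lemma conjugate_one: "conjugate (1 :: 'a::conjugatable_field) = 1"
proof -
  have "conjugate (1::'a) * conjugate 1 = conjugate 1 * 1"
    by (simp flip: conjugate_dist_mul)
  moreover have "conjugate (1::'a) \<noteq> 0"
    by simp
  ultimately show ?thesis
    using mult_cancel_left by blast
qed

lemma conjugate_power: "conjugate ((a :: 'a::conjugatable_field) ^ m) = conjugate a ^ m"
  by (induction m) (simp_all add: conjugate_one conjugate_dist_mul)

lemma sum_list_concat_map:
  "sum_list (concat (map f xs)) = (\<Sum>x\<leftarrow>xs. sum_list (f x :: 'a::monoid_add list))"
  by (induction xs) simp_all

text \<open>The multisets of size \<open>s\<close> on \<open>r + 1\<close> points, sorted by the number \<open>u\<close> of their elements
  that differ from a chosen point.\<close>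

lemma sum_multichoose: "(\<Sum>u\<le>s. (r + u - 1) choose u) = (r + s) choose s"
proof (cases r)
  case 0
  have "(\<Sum>u\<le>s. (u - 1) choose u) = (\<Sum>u\<in>{0}. (u - 1) choose u)"
    by (rule sum.mono_neutral_right) (auto simp: binomial_eq_0)
  then show ?thesis
    using 0 by simp
next
  case (Suc m)
  then show ?thesis
    using sum_choose_lower[of m s] by simp
qed

lemma num_nonzero_mono:
  assumes "dim_vec w = dim_vec v"
    and "\<And>i. i < dim_vec v \<Longrightarrow> v $ i = 0 \<Longrightarrow> w $ i = 0"
  shows "num_nonzero w \<le> num_nonzero v"
  unfolding num_nonzero_def by (rule card_mono) (use assms in auto)

definition gram_sum :: "'a::conjugatable_ring vec list \<Rightarrow> nat \<Rightarrow> nat \<Rightarrow> 'a" where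
  "gram_sum vs i j = (\<Sum>v\<leftarrow>vs. v $ i * conjugate (v $ j))"

lemma foldr_outer_square:
  assumes "\<forall>v \<in> set vs. v \<in> carrier_vec n"
  shows "foldr (+) (map outer_square vs) (0\<^sub>m n n) = mat n n (\<lambda>(i, j). gram_sum vs i j)"
  using assms
proof (induction vs)
  case Nil
  show ?case
    by (rule eq_matI) (simp_all add: gram_sum_def)
next
  case (Cons v vs)
  then show ?case
    by (intro eq_matI) (auto simp: outer_square_def gram_sum_def)
qed

lemma sparse_decomposition_iff_gram_sum:
  assumes "A \<in> carrier_mat n n"
  shows "sparse_decomposition k A vs \<longleftrightarrow>
    (\<forall>v \<in> set vs. v \<in> carrier_vec n \<and> num_nonzero v \<le> k) \<and>
    (\<forall>i < n. \<forall>j < n. A $$ (i, j) = gram_sum vs i j)"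
proof -
  have "A = mat n n (\<lambda>(i, j). gram_sum vs i j) \<longleftrightarrow>
      (\<forall>i < n. \<forall>j < n. A $$ (i, j) = gram_sum vs i j)"
    using assms by (auto intro!: eq_matI)
  then show ?thesis
    using assms foldr_outer_square[of vs n] unfolding sparse_decomposition_def by auto
qed

text \<open>The exponent \<open>0\<close> is included because it occurs in the binomial expansion; the
  target there is the all-ones matrix, whose vector has no zero entry. This does no harm: for
  \<open>s \<ge> 1\<close> the expansion multiplies that vector by a positive power of the vector that was
  split off, which makes the product sparse.\<close>

lemma gram_sum_power_expansion:
  fixes vs :: "'a::conjugatable_field vec list"
  assumes root: "\<And>m. \<exists>c::'a. c * conjugate c = of_nat m"
    and "\<forall>v \<in> set vs. v \<in> carrier_vec n \<and> num_nonzero v \<le> k"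
  shows "\<exists>ws. length ws = (length vs + s - 1) choose s \<and>
    (\<forall>w \<in> set ws. w \<in> carrier_vec n \<and> (s = 0 \<or> num_nonzero w \<le> k)) \<and>
    (\<forall>i < n. \<forall>j < n. gram_sum ws i j = gram_sum vs i j ^ s)"
  using assms(2)
proof (induction vs arbitrary: s)
  case Nil
  show ?case
  proof (cases "s = 0")
    case True
    then show ?thesis
      by (intro exI[of _ "[vec n (\<lambda>_. 1)]"]) (simp add: gram_sum_def conjugate_one)
  next
    case False
    then show ?thesis
      by (intro exI[of _ "[]"]) (simp add: gram_sum_def binomial_eq_0)
  qed
next
  case (Cons v vs)
  have v: "v \<in> carrier_vec n" "num_nonzero v \<le> k"
    using Cons.prems by auto
  have "\<forall>u. \<exists>ws. length ws = (length vs + u - 1) choose u \<and>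
      (\<forall>w \<in> set ws. w \<in> carrier_vec n \<and> (u = 0 \<or> num_nonzero w \<le> k)) \<and>
      (\<forall>i < n. \<forall>j < n. gram_sum ws i j = gram_sum vs i j ^ u)"
    using Cons by simp
  then obtain W where W_length: "\<And>u. length (W u) = (length vs + u - 1) choose u"
    and W_sparse: "\<And>u w. w \<in> set (W u) \<Longrightarrow> w \<in> carrier_vec n \<and> (u = 0 \<or> num_nonzero w \<le> k)"
    and W_sum: "\<And>u i j. i < n \<Longrightarrow> j < n \<Longrightarrow> gram_sum (W u) i j = gram_sum vs i j ^ u"
    by metis
  have "\<forall>u. \<exists>c::'a. c * conjugate c = of_nat (s choose u)"
    using root by blast
  then obtain c :: "nat \<Rightarrow> 'a" where c: "\<And>u. c u * conjugate (c u) = of_nat (s choose u)"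
    by metis
  define term_vec where "term_vec u w = vec n (\<lambda>i. c u * v $ i ^ (s - u) * w $ i)" for u w
  define ws where "ws = concat (map (\<lambda>u. map (term_vec u) (W u)) [0..<Suc s])"

  have "length ws = (\<Sum>u\<leftarrow>[0..<Suc s]. (length vs + u - 1) choose u)"
    by (simp add: ws_def length_concat o_def W_length)
  also have "\<dots> = (\<Sum>u\<le>s. (length vs + u - 1) choose u)"
    by (simp only: interv_sum_list_conv_sum_set_nat set_upt atLeast0LessThan lessThan_Suc_atMost)
  finally have ws_length: "length ws = (length (v # vs) + s - 1) choose s"
    using sum_multichoose[of "length vs" s] by simp

  have ws_sparse: "w \<in> carrier_vec n \<and> (s = 0 \<or> num_nonzero w \<le> k)" if w_in: "w \<in> set ws" for w
  proof -
    obtain u w' where u: "u \<le> s" and w': "w' \<in> set (W u)" and w: "w = term_vec u w'"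
      using w_in by (auto simp: ws_def less_Suc_eq_le simp del: upt_Suc)
    have "num_nonzero w \<le> k" if "s \<noteq> 0"
    proof (cases "u = s")
      case True
      then have "num_nonzero w' \<le> k"
        using W_sparse[OF w'] that by simp
      moreover have "num_nonzero w \<le> num_nonzero w'"
        by (rule num_nonzero_mono) (use W_sparse[OF w'] in \<open>auto simp: w term_vec_def\<close>)
      ultimately show ?thesis
        by simp
    next
      case False
      then have "num_nonzero w \<le> num_nonzero v"
        using u v by (intro num_nonzero_mono) (auto simp: w term_vec_def)
      then show ?thesis
        using v by simp
    qed
    then show ?thesis
      by (auto simp: w term_vec_def)
  qed

  have ws_sum: "gram_sum ws i j = gram_sum (v # vs) i j ^ s" if ij: "i < n" "j < n" for i j
  proof -
    let ?x = "v $ i * conjugate (v $ j)"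
    have summand: "gram_sum (map (term_vec u) (W u)) i j
        = of_nat (s choose u) * gram_sum vs i j ^ u * ?x ^ (s - u)" for u
    proof -
      have "gram_sum (map (term_vec u) (W u)) i j
          = (\<Sum>w\<leftarrow>W u. (c u * conjugate (c u) * ?x ^ (s - u)) * (w $ i * conjugate (w $ j)))"
        using ij by (simp add: gram_sum_def term_vec_def o_def conjugate_dist_mul conjugate_power
            power_mult_distrib mult_ac)
      also have "\<dots> = of_nat (s choose u) * ?x ^ (s - u) * gram_sum (W u) i j"
        by (simp add: c gram_sum_def sum_list_const_mult)
      finally show ?thesis
        using W_sum[OF ij] by (simp add: mult_ac)
    qed
    have "gram_sum ws i j = (\<Sum>u\<leftarrow>[0..<Suc s]. gram_sum (map (term_vec u) (W u)) i j)"
      by (simp add: ws_def gram_sum_def map_concat sum_list_concat_map o_def del: upt_Suc)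
    also have "\<dots> = (\<Sum>u\<le>s. of_nat (s choose u) * gram_sum vs i j ^ u * ?x ^ (s - u))"
      by (simp only: summand interv_sum_list_conv_sum_set_nat set_upt atLeast0LessThan
          lessThan_Suc_atMost)
    also have "\<dots> = (gram_sum vs i j + ?x) ^ s"
      by (simp only: binomial_ring)
    finally show ?thesis
      by (simp add: gram_sum_def add.commute)
  qed

  show ?case
    using ws_length ws_sparse ws_sum by blast
qed

lemma fran_attained:
  assumes "sparse_decomposition k A vs"
  obtains vs' where "sparse_decomposition k A vs'" "length vs' = fran k A"
  using LeastI_ex[of "\<lambda>r. \<exists>vs. sparse_decomposition k A vs \<and> length vs = r"] assms
  unfolding fran_def by blast

lemma fran_le_length:
  assumes "sparse_decomposition k A vs"
  shows "fran k A \<le> length vs"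
  unfolding fran_def by (rule Least_le) (use assms in blast)

lemma hadamard_power_factor_width_fran:
  fixes A :: "'a::conjugatable_ordered_field mat"
  assumes root: "\<And>m. \<exists>c::'a. c * conjugate c = of_nat m"
    and s: "s \<ge> 1" and k: "k \<ge> 1"
    and A: "A \<in> carrier_mat n n" and width: "factor_width A \<le> enat k"
  shows "factor_width (hadamard_power A s) \<le> enat k \<and>
    fran k (hadamard_power A s) \<le> (fran k A + s - 1) choose s"
proof -
  obtain vs where vs: "sparse_decomposition k A vs" and vs_length: "length vs = fran k A"
    using width factor_width_le_iff[OF k] fran_attained by metis
  have vs_sparse: "\<forall>v \<in> set vs. v \<in> carrier_vec n \<and> num_nonzero v \<le> k"
    and vs_sum: "\<And>i j. i < n \<Longrightarrow> j < n \<Longrightarrow> A $$ (i, j) = gram_sum vs i j"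
    using vs unfolding sparse_decomposition_iff_gram_sum[OF A] by auto
  obtain ws where ws_length: "length ws = (length vs + s - 1) choose s"
    and ws_sparse: "\<forall>w \<in> set ws. w \<in> carrier_vec n \<and> num_nonzero w \<le> k"
    and ws_sum: "\<And>i j. i < n \<Longrightarrow> j < n \<Longrightarrow> gram_sum ws i j = gram_sum vs i j ^ s"
    using gram_sum_power_expansion[OF root vs_sparse, of s] s by auto
  have "hadamard_power A s \<in> carrier_mat n n"
    using A by (simp add: hadamard_power_def)
  then have ws: "sparse_decomposition k (hadamard_power A s) ws"
    using ws_sparse ws_sum vs_sum A
    by (simp add: sparse_decomposition_iff_gram_sum hadamard_power_def)
  show ?thesis
  proof
    show "factor_width (hadamard_power A s) \<le> enat k"
      using ws factor_width_le_iff[OF k] by blast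
    show "fran k (hadamard_power A s) \<le> (fran k A + s - 1) choose s"
      using fran_le_length[OF ws] ws_length vs_length by simp
  qed
qed

theorem theorem8:
  fixes s k n :: nat
  assumes "s \<ge> 1" and "k \<ge> 1"
  shows "(\<forall>A :: real mat. A \<in> psd_mats n \<longrightarrow> factor_width A \<le> enat k \<longrightarrow>
            factor_width (hadamard_power A s) \<le> enat k \<and>
            fran k (hadamard_power A s) \<le> (fran k A + s - 1) choose s) \<and>
         (\<forall>A :: complex mat. A \<in> psd_mats n \<longrightarrow> factor_width A \<le> enat k \<longrightarrow>
            factor_width (hadamard_power A s) \<le> enat k \<and>
            fran k (hadamard_power A s) \<le> (fran k A + s - 1) choose s)"
proof -
  have real_root: "\<exists>c::real. c * conjugate c = of_nat m" for m
    by (intro exI[of _ "sqrt (real m)"]) simp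
  have complex_root: "\<exists>c::complex. c * conjugate c = of_nat m" for m
    by (intro exI[of _ "complex_of_real (sqrt (real m))"]) (simp flip: of_real_mult)
  show ?thesis
    using hadamard_power_factor_width_fran[OF real_root assms]
      hadamard_power_factor_width_fran[OF complex_root assms]
    unfolding psd_mats_def by blast
qed

end
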